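(* If a product of spaces with enough arcs is metrizable, then it has the $\mathcal{AF}$-property. In particular, a countable product of metrizable spaces with enough arcs has the $\mathcal{AF}$-property.
   Context: For a metrizable space $X$, a continuous map $f\colon X\to X$ and a point $x\in X$, the $\alpha$-limit set of $x$ is $\alpha_f(x)=\bigcap_{n\ge 0}\overline{\bigcup_{k\ge n} f^{-k}(x)}$, where $f^{-k}(x)=\{y\in X: f^k(y)=x\}$. A set $A\subseteq X$ is an $\alpha$-limit set in $X$ if $A=\alpha_f(x)$ for some continuous $f\colon X\to X$ and some $x\in X$. A metrizable space $X$ has the $\mathcal{AF}$-property if the family of $\alpha$-limit sets in $X$ coincides with the family of closed subsets of $X$ (including $\emptyset$ and $X$). An arc is a homeomorphic copy of $[0,1]$. A space with enough arcs is a nondegenerate metrizable space $X$ (i.e. one with at least two points) such that for every nonempty proper closed subset $A\subseteq X$ there is an arc in $X$ with one endpoint in $A$ and the other endpoint in $X\setminus A$. Products carry the product topology. *)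

theory Defs
  imports "HOL-Analysis.Analysis"
begin

definition alpha_limit :: "'a topology \<Rightarrow> ('a \<Rightarrow> 'a) \<Rightarrow> 'a \<Rightarrow> 'a set" where
  "alpha_limit X f x =
     (\<Inter>n. X closure_of (\<Union>k\<in>{n..}. {y \<in> topspace X. (f ^^ k) y = x}))"

definition alpha_limit_set_in :: "'a topology \<Rightarrow> 'a set \<Rightarrow> bool" where
  "alpha_limit_set_in X A \<longleftrightarrow>
     (\<exists>f x. continuous_map X X f \<and> x \<in> topspace X \<and> A = alpha_limit X f x)"

definition AF_property :: "'a topology \<Rightarrow> bool" where
  "AF_property X \<longleftrightarrow>
     metrizable_space X \<and> {A. alpha_limit_set_in X A} = {A. closedin X A}"

text \<open>The set \<open>C\<close> is an arc in \<open>X\<close> with endpoints \<open>a\<close> and \<open>b\<close>.\<close>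

definition arc_between :: "'a topology \<Rightarrow> 'a set \<Rightarrow> 'a \<Rightarrow> 'a \<Rightarrow> bool" where
  "arc_between X C a b \<longleftrightarrow>
     C \<subseteq> topspace X \<and>
     (\<exists>g. homeomorphic_map (top_of_set {0..1::real}) (subtopology X C) g \<and> g 0 = a \<and> g 1 = b)"

definition enough_arcs :: "'a topology \<Rightarrow> bool" where
  "enough_arcs X \<longleftrightarrow>
     metrizable_space X \<and>
     (\<exists>x\<in>topspace X. \<exists>y\<in>topspace X. x \<noteq> y) \<and>
     (\<forall>A. closedin X A \<and> A \<noteq> {} \<and> A \<noteq> topspace X \<longrightarrow>
        (\<exists>C a b. arc_between X C a b \<and> a \<in> A \<and> b \<in> topspace X - A))"

end

theory Submission imports Defs begin

text \<open>
  The heart of the matter is that a closed set \<open>A\<close> is trivially an \<open>\<alpha>\<close>-limit set as soon as some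
  continuous \<open>f\<close> collapses \<open>A\<close> to a point \<open>x \<in> A\<close> and sends everything else outside \<open>A\<close>: then
  \<open>f\<^sup>-\<^sup>k(x) = A\<close> for all \<open>k \<ge> 1\<close> (lemma \<open>alpha_limit_collapse\<close>).  To build such an \<open>f\<close> for a
  nonempty proper closed \<open>A\<close>, take a path that starts in \<open>A\<close> and leaves it.  Cutting the path at
  its last visit to \<open>A\<close> gives a path \<open>g\<close> that is in \<open>A\<close> at time \<open>0\<close> only
  (\<open>path_leaving_immediately\<close>).  If \<open>\<phi> : X \<rightarrow> [0,1]\<close> is continuous with zero set exactly \<open>A\<close>, for
  instance a truncated distance, then \<open>f = g \<circ> \<phi>\<close> works with \<open>x = g 0\<close>.  The two remaining closed
  sets are obtained from constant maps.

  So only paths leaving \<open>A\<close> matter, not arcs, and this weaker property passes to products: a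
  nonempty closed set that no path leaves by moving a single coordinate is invariant under changing finitely many
  coordinates, hence dense, hence everything (\<open>escaping_paths_product_topology\<close>).  Consequently
  every metrizable product of spaces with enough arcs has the property, and countable products of
  metrizable spaces are metrizable.
\<close>

section \<open>Closed sets as \<open>\<alpha>\<close>-limit sets\<close>

lemma closedin_alpha_limit: "closedin X (alpha_limit X f x)"
  unfolding alpha_limit_def by (intro closedin_Inter) auto

text \<open>
  Under these hypotheses the orbit of a point can meet \<open>A\<close> after the first step only by
  sitting at \<open>x\<close>, which happens exactly when it started in \<open>A\<close>.
\<close>

lemma alpha_limit_collapse:
  assumes A: "closedin X A" and x: "x \<in> A"
    and f: "f \<in> topspace X \<rightarrow> topspace X"
    and collapse: "\<And>z. z \<in> topspace X \<Longrightarrow> f z = x \<longleftrightarrow> z \<in> A"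
    and avoid: "\<And>z. z \<in> topspace X \<Longrightarrow> f z \<in> A \<Longrightarrow> f z = x"
  shows "alpha_limit X f x = A"
proof -
  have iter: "(f ^^ Suc k) z = x \<longleftrightarrow> z \<in> A" if "z \<in> topspace X" for k z
    using that
  proof (induction k arbitrary: z)
    case 0
    then show ?case using collapse by simp
  next
    case (Suc k)
    have "f z \<in> topspace X" using f Suc.prems by auto
    with Suc.IH have "(f ^^ Suc k) (f z) = x \<longleftrightarrow> f z \<in> A" by blast
    also have "\<dots> \<longleftrightarrow> z \<in> A" using collapse avoid x Suc.prems by metis
    finally show ?case by (simp add: funpow_swap1)
  qed
  have sub: "A \<subseteq> topspace X" using A closedin_subset by blast
  have fibre: "{y \<in> topspace X. (f ^^ k) y = x} = (if k = 0 then {x} else A)" for k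
    using iter sub x by (cases k) auto
  have "(\<Union>k\<in>{n..}. {y \<in> topspace X. (f ^^ k) y = x}) = A" for n
  proof (rule antisym)
    show "(\<Union>k\<in>{n..}. {y \<in> topspace X. (f ^^ k) y = x}) \<subseteq> A"
      unfolding fibre using x by (auto split: if_splits)
    show "A \<subseteq> (\<Union>k\<in>{n..}. {y \<in> topspace X. (f ^^ k) y = x})"
      unfolding fibre by (auto intro!: bexI[of _ "Suc n"])
  qed
  then show ?thesis
    using A by (simp add: alpha_limit_def closure_of_closedin)
qed

text \<open>If \<open>f\<close> is constant with value \<open>c \<noteq> x\<close>, then \<open>x\<close> has no preimages beyond itself.\<close>

lemma alpha_limit_set_in_empty:
  assumes "x \<in> topspace X" "c \<in> topspace X" "x \<noteq> c"
  shows "alpha_limit_set_in X {}"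
proof -
  have "(\<Union>k\<in>{1..}. {y \<in> topspace X. ((\<lambda>_. c) ^^ k) y = x}) = {}"
    using assms(3) by (auto simp: Suc_le_eq gr0_conv_Suc)
  then have "alpha_limit X (\<lambda>_. c) x = {}"
    unfolding alpha_limit_def by (metis (no_types, lifting) INF_lower UNIV_I closure_of_empty subset_empty)
  then show ?thesis
    using assms unfolding alpha_limit_set_in_def
    by (intro exI[of _ "\<lambda>_. c"] exI[of _ x]) auto
qed

lemma alpha_limit_set_in_topspace:
  assumes x: "x \<in> topspace X"
  shows "alpha_limit_set_in X (topspace X)"
proof -
  have "alpha_limit X (\<lambda>_. x) x = topspace X"
    using x by (intro alpha_limit_collapse) auto
  then show ?thesis
    using x unfolding alpha_limit_set_in_def
    by (intro exI[of _ "\<lambda>_. x"] exI[of _ x]) auto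
qed

section \<open>Functions with prescribed zero set\<close>

text \<open>
  This is how metrizability enters: not every closed set of a normal space is a zero set.
  The witness is the distance to \<open>A\<close>, truncated at \<open>1\<close>.  For \<open>A = {}\<close> that infimum is over the
  empty set, so this case is treated separately.
\<close>

lemma metrizable_closedin_zero_set:
  assumes "metrizable_space X" and A: "closedin X A"
  obtains \<phi> where "continuous_map X (top_of_set {0..1::real}) \<phi>"
    and "\<And>z. z \<in> topspace X \<Longrightarrow> \<phi> z = 0 \<longleftrightarrow> z \<in> A"
proof (cases "A = {}")
  case True
  show ?thesis
    by (rule that[of "\<lambda>_. 1"]) (use True in \<open>auto simp: continuous_map_in_subtopology\<close>)
next
  case False
  obtain M d where "Metric_space M d" and X: "X = Metric_space.mtopology M d"
    using assms unfolding metrizable_space_def by blast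
  then interpret Metric_space M d by blast
  have AM: "A \<subseteq> M" using A X closedin_metric by blast
  define D where "D \<equiv> \<lambda>z. INF a\<in>A. d z a"
  have bdd: "bdd_below (d z ` A)" for z
    by (meson bdd_belowI2 nonneg)
  have D_nonneg: "0 \<le> D z" for z
    unfolding D_def using False by (intro cINF_greatest) auto
  have D_le: "D z \<le> d z a" if "a \<in> A" for z a
    unfolding D_def using bdd that by (intro cINF_lower)
  have lip: "D y \<le> d y z + D z" if "y \<in> M" "z \<in> M" for y z
  proof -
    have "D y - d y z \<le> d z a" if "a \<in> A" for a
      using D_le[OF that, of y] triangle[of y z a] \<open>y \<in> M\<close> \<open>z \<in> M\<close> that AM by force
    then have "D y - d y z \<le> (INF a\<in>A. d z a)"
      using False by (intro cINF_greatest) auto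
    then show ?thesis by (simp add: D_def)
  qed
  have "Lipschitz_continuous_map Self euclidean_metric D"
    unfolding Lipschitz_continuous_map_def
  proof (intro conjI exI[of _ 1] ballI)
    fix y z assume "y \<in> mspace Self" "z \<in> mspace Self"
    then have "y \<in> M" "z \<in> M" by auto
    with lip[of y z] lip[of z y] show "mdist euclidean_metric (D y) (D z) \<le> 1 * mdist Self y z"
      by (simp add: dist_real_def commute abs_le_iff)
  qed auto
  from Lipschitz_continuous_imp_continuous_map[OF this]
  have contD: "continuous_map X euclideanreal D" by (simp add: X Self_def)
  have zero: "D z = 0 \<longleftrightarrow> z \<in> A" if "z \<in> M" for z
  proof
    assume "z \<in> A"
    with D_le[of z z] D_nonneg[of z] that show "D z = 0" by simp
  next
    assume D0: "D z = 0"
    show "z \<in> A"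
    proof (rule ccontr)
      assume "z \<notin> A"
      then obtain r where r: "r > 0" "disjnt A (mball z r)"
        using A \<open>z \<in> M\<close> unfolding X closedin_metric by blast
      have "r \<le> d z a" if "a \<in> A" for a
        using r that AM \<open>z \<in> M\<close> by (auto simp: disjnt_iff not_less[symmetric])
      then have "r \<le> D z" unfolding D_def using False by (intro cINF_greatest) auto
      with D0 r show False by simp
    qed
  qed
  show ?thesis
  proof
    show "continuous_map X (top_of_set {0..1}) (\<lambda>z. min 1 (D z))"
      using D_nonneg contD
      by (auto simp: continuous_map_in_subtopology intro!: continuous_map_real_min)
    show "min 1 (D z) = 0 \<longleftrightarrow> z \<in> A" if "z \<in> topspace X" for z
      using zero[of z] that by (auto simp: X min_def)
  qed
qed

section \<open>Paths leaving closed sets\<close>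

definition escaping_paths :: "'a topology \<Rightarrow> bool" where
  "escaping_paths X \<longleftrightarrow>
     (\<forall>A. closedin X A \<and> A \<noteq> {} \<and> A \<noteq> topspace X \<longrightarrow> (\<exists>g. pathin X g \<and> g 0 \<in> A \<and> g 1 \<notin> A))"

lemma enough_arcs_imp_escaping_paths:
  assumes "enough_arcs X" shows "escaping_paths X"
  unfolding escaping_paths_def
proof (intro allI impI)
  fix A assume "closedin X A \<and> A \<noteq> {} \<and> A \<noteq> topspace X"
  then obtain C a b where ab: "arc_between X C a b" "a \<in> A" "b \<in> topspace X - A"
    using assms unfolding enough_arcs_def by blast
  then obtain g where g: "homeomorphic_map (top_of_set {0..1::real}) (subtopology X C) g"
    and "g 0 = a" "g 1 = b"
    unfolding arc_between_def by blast
  have "pathin X g"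
    using homeomorphic_imp_continuous_map[OF g] unfolding pathin_def
    by (simp add: continuous_map_in_subtopology)
  with ab \<open>g 0 = a\<close> \<open>g 1 = b\<close> show "\<exists>g. pathin X g \<and> g 0 \<in> A \<and> g 1 \<notin> A" by blast
qed

text \<open>The new path is the part of the old one after its last visit to \<open>A\<close>.\<close>

lemma path_leaving_immediately:
  assumes A: "closedin X A" and g: "pathin X g" and "g 0 \<in> A" "g 1 \<notin> A"
  obtains h where "pathin X h" "\<And>t. t \<in> {0..1} \<Longrightarrow> h t \<in> A \<longleftrightarrow> t = 0"
proof -
  define T where "T = {t \<in> {0..1}. g t \<in> A}"
  have "closedin (top_of_set {0..1}) T"
    using closedin_continuous_map_preimage[OF g[unfolded pathin_def] A] by (simp add: T_def)
  then have "compact T"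
    by (meson closedin_compact compact_Icc)
  moreover have "T \<noteq> {}" using \<open>g 0 \<in> A\<close> by (force simp: T_def)
  ultimately obtain s where s: "s \<in> T" and last: "\<And>t. t \<in> T \<Longrightarrow> t \<le> s"
    using compact_attains_sup[of T] by auto
  \<comment> \<open>Strictness keeps the reparametrisation \<open>r\<close> of \<open>[s,1]\<close> injective.\<close>
  have s01: "0 \<le> s" "s < 1"
    using s \<open>g 1 \<notin> A\<close> by (auto simp: T_def less_le)
  define r where "r = (\<lambda>t. s + (1 - s) * t)"
  have r01: "r t \<in> {0..1}" if "t \<in> {0..1}" for t
  proof -
    have "(1 - s) * t \<le> 1 - s" "0 \<le> (1 - s) * t"
      using that s01 mult_left_le[of t "1 - s"] by auto
    then show ?thesis using s01 unfolding r_def atLeastAtMost_iff by linarith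
  qed
  have "continuous_map (top_of_set {0..1}) (top_of_set {0..1}) r"
    using r01 by (auto simp: r_def continuous_map_in_subtopology intro!: continuous_intros)
  then have "pathin X (g \<circ> r)"
    using g unfolding pathin_def by (rule continuous_map_compose)
  moreover have "(g \<circ> r) t \<in> A \<longleftrightarrow> t = 0" if "t \<in> {0..1}" for t
  proof
    assume "(g \<circ> r) t \<in> A"
    then have "r t \<le> s" using last r01[OF that] by (simp add: T_def)
    then show "t = 0" using that s01 by (simp add: r_def mult_le_0_iff)
  next
    assume "t = 0"
    then show "(g \<circ> r) t \<in> A" using s by (simp add: r_def T_def)
  qed
  ultimately show ?thesis by (rule that)
qed

theorem escaping_paths_imp_AF_property:
  assumes met: "metrizable_space X" and ab: "a \<in> topspace X" "b \<in> topspace X" "a \<noteq> b"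
    and esc: "escaping_paths X"
  shows "AF_property X"
proof -
  have realise: "alpha_limit_set_in X A" if A: "closedin X A" for A
  proof -
    consider "A = {}" | "A = topspace X" | "A \<noteq> {}" "A \<noteq> topspace X" by blast
    then show ?thesis
    proof cases
      case 1
      with alpha_limit_set_in_empty[OF ab] show ?thesis by simp
    next
      case 2
      with alpha_limit_set_in_topspace[OF ab(1)] show ?thesis by simp
    next
      case 3
      then obtain g where "pathin X g" "g 0 \<in> A" "g 1 \<notin> A"
        using esc A unfolding escaping_paths_def by blast
      then obtain h where h: "pathin X h" "\<And>t. t \<in> {0..1} \<Longrightarrow> h t \<in> A \<longleftrightarrow> t = 0"
        using path_leaving_immediately[OF A] by blast
      obtain \<phi> where \<phi>: "continuous_map X (top_of_set {0..1::real}) \<phi>"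
        "\<And>z. z \<in> topspace X \<Longrightarrow> \<phi> z = 0 \<longleftrightarrow> z \<in> A"
        using metrizable_closedin_zero_set[OF met A] by blast
      have \<phi>01: "\<phi> z \<in> {0..1}" if "z \<in> topspace X" for z
        using continuous_map_image_subset_topspace[OF \<phi>(1)] that by auto
      have h0: "h 0 \<in> A" using h(2)[of 0] by simp
      have cont: "continuous_map X X (h \<circ> \<phi>)"
        using \<phi>(1) h(1) unfolding pathin_def by (rule continuous_map_compose)
      have "alpha_limit X (h \<circ> \<phi>) (h 0) = A"
      proof (rule alpha_limit_collapse[OF A h0])
        show "h \<circ> \<phi> \<in> topspace X \<rightarrow> topspace X"
          using cont by (simp add: continuous_map_def)
        fix z assume z: "z \<in> topspace X"
        have in_A: "(h \<circ> \<phi>) z \<in> A \<longleftrightarrow> \<phi> z = 0" using h(2)[OF \<phi>01[OF z]] by simp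
        then show "(h \<circ> \<phi>) z = h 0 \<longleftrightarrow> z \<in> A" using \<phi>(2)[OF z] h0 by auto
        show "(h \<circ> \<phi>) z = h 0" if "(h \<circ> \<phi>) z \<in> A" using that in_A by simp
      qed
      moreover have "h 0 \<in> topspace X" using h0 closedin_subset[OF A] by blast
      ultimately show ?thesis
        using cont unfolding alpha_limit_set_in_def by metis
    qed
  qed
  have "alpha_limit_set_in X A \<longleftrightarrow> closedin X A" for A
    using realise[of A] closedin_alpha_limit by (auto simp: alpha_limit_set_in_def)
  then show ?thesis
    using met by (simp add: AF_property_def)
qed

section \<open>Products\<close>

lemma continuous_map_fun_upd_product:
  assumes "a \<in> topspace (product_topology X I)" "i \<in> I"
  shows "continuous_map (X i) (product_topology X I) (\<lambda>x. a(i := x))"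
  using assms
  by (auto simp: continuous_map_componentwise PiE_iff extensional_def)

text \<open>
  Finitely many single-coordinate changes turn a point of \<open>A\<close> into one that lies in any given
  basic open box, so \<open>A\<close> is dense.
\<close>

lemma closedin_product_coordinatewise_invariant:
  assumes A: "closedin (product_topology X I) A" and "A \<noteq> {}"
    and inv: "\<And>a i x. a \<in> A \<Longrightarrow> i \<in> I \<Longrightarrow> x \<in> topspace (X i) \<Longrightarrow> a(i := x) \<in> A"
  shows "A = topspace (product_topology X I)"
proof -
  let ?P = "product_topology X I"
  have sub: "A \<subseteq> topspace ?P" using A closedin_subset by blast
  obtain a where a: "a \<in> A" using \<open>A \<noteq> {}\<close> by blast
  have override: "override_on a y J \<in> A" if "finite J" "J \<subseteq> I" "y \<in> topspace ?P" for y J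
    using that
  proof (induction J rule: finite_induct)
    case empty
    then show ?case using a by simp
  next
    case (insert i J)
    then have "(override_on a y J)(i := y i) \<in> A"
      by (intro inv) (auto simp: PiE_iff)
    also have "(override_on a y J)(i := y i) = override_on a y (insert i J)"
      by (auto simp: override_on_def)
    finally show ?case .
  qed
  have "y \<in> ?P closure_of A" if y: "y \<in> topspace ?P" for y
    unfolding in_closure_of
  proof (intro conjI allI impI)
    fix W assume "y \<in> W \<and> openin ?P W"
    then obtain U where fin: "finite {i \<in> I. U i \<noteq> topspace (X i)}"
      and U: "y \<in> Pi\<^sub>E I U" "Pi\<^sub>E I U \<subseteq> W"
      unfolding openin_product_topology_alt by blast
    let ?J = "{i \<in> I. U i \<noteq> topspace (X i)}"
    have "override_on a y ?J \<in> A" using override fin y by blast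
    moreover have "override_on a y ?J \<in> Pi\<^sub>E I U"
      using U(1) a sub by (fastforce simp: override_on_def PiE_iff extensional_def)
    ultimately show "\<exists>z. z \<in> A \<and> z \<in> W" using U(2) by blast
  qed (use y in simp)
  then show ?thesis
    using A sub by (metis closure_of_closedin subsetI subset_antisym)
qed

lemma escaping_paths_product_topology:
  assumes esc: "\<And>i. i \<in> I \<Longrightarrow> escaping_paths (X i)"
  shows "escaping_paths (product_topology X I)"
  unfolding escaping_paths_def
proof (intro allI impI)
  let ?P = "product_topology X I"
  fix A assume A: "closedin ?P A \<and> A \<noteq> {} \<and> A \<noteq> topspace ?P"
  have "\<exists>a\<in>A. \<exists>i\<in>I. \<exists>x\<in>topspace (X i). a(i := x) \<notin> A"
  proof (rule ccontr)
    assume "\<not> ?thesis"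
    then have "A = topspace ?P"
      using A by (intro closedin_product_coordinatewise_invariant) auto
    with A show False by simp
  qed
  then obtain a i x where a: "a \<in> A" and i: "i \<in> I" and x: "x \<in> topspace (X i)"
    and out: "a(i := x) \<notin> A"
    by blast
  have aP: "a \<in> topspace ?P" using a A closedin_subset by blast
  note upd = continuous_map_fun_upd_product[OF aP i]
  let ?B = "{z \<in> topspace (X i). a(i := z) \<in> A}"
  have "closedin (X i) ?B" using closedin_continuous_map_preimage[OF upd] A by blast
  moreover have "a i \<in> ?B" using a aP i by (auto simp: PiE_iff)
  moreover have "?B \<noteq> topspace (X i)" using x out by blast
  ultimately obtain g where g: "pathin (X i) g" "g 0 \<in> ?B" "g 1 \<notin> ?B"
    using esc[OF i] unfolding escaping_paths_def by blast
  have "g 1 \<in> topspace (X i)"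
    using g(1) unfolding pathin_def by (auto dest!: continuous_map_image_subset_topspace)
  moreover have "pathin ?P ((\<lambda>x. a(i := x)) \<circ> g)"
    using g(1) upd by (rule pathin_compose)
  ultimately show "\<exists>g. pathin ?P g \<and> g 0 \<in> A \<and> g 1 \<notin> A"
    using g by (intro exI[of _ "(\<lambda>x. a(i := x)) \<circ> g"]) auto
qed

lemma product_topology_two_points:
  assumes "i \<in> I" and two: "\<And>j. j \<in> I \<Longrightarrow> \<exists>x\<in>topspace (X j). \<exists>y\<in>topspace (X j). x \<noteq> y"
  obtains a b where "a \<in> topspace (product_topology X I)" "b \<in> topspace (product_topology X I)"
    "a \<noteq> b"
proof -
  obtain p q where pq: "\<And>j. j \<in> I \<Longrightarrow> p j \<in> topspace (X j) \<and> q j \<in> topspace (X j) \<and> p j \<noteq> q j"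
    using two by metis
  then have "restrict p I \<noteq> restrict q I"
    using \<open>i \<in> I\<close> by (metis restrict_apply')
  then show ?thesis using pq by (intro that[of "restrict p I" "restrict q I"]) auto
qed

theorem corollary20:
  fixes X :: "'i \<Rightarrow> 'a topology" and I :: "'i set"
  assumes "I \<noteq> {}"
    and "\<And>i. i \<in> I \<Longrightarrow> enough_arcs (X i)"
  shows "(metrizable_space (product_topology X I) \<longrightarrow> AF_property (product_topology X I)) \<and>
         (countable I \<longrightarrow> AF_property (product_topology X I))"
proof -
  let ?P = "product_topology X I"
  obtain i where "i \<in> I" using assms(1) by blast
  have "\<exists>x\<in>topspace (X j). \<exists>y\<in>topspace (X j). x \<noteq> y" if "j \<in> I" for j
    using assms(2)[OF that] unfolding enough_arcs_def by blast
  then obtain a b where ab: "a \<in> topspace ?P" "b \<in> topspace ?P" "a \<noteq> b"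
    using product_topology_two_points[OF \<open>i \<in> I\<close>] by metis
  have "escaping_paths ?P"
    using assms(2) by (intro escaping_paths_product_topology enough_arcs_imp_escaping_paths)
  then have "AF_property ?P" if "metrizable_space ?P"
    using escaping_paths_imp_AF_property[OF that ab] by simp
  moreover have "metrizable_space ?P" if "countable I"
    using assms(2) that unfolding metrizable_space_product_topology enough_arcs_def
    by simp
  ultimately show ?thesis by blast
qed

end
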